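(* For every even $d\ge2$ there exist, for every $n$, $n$-vertex $d$-hypercuts over $\mathbb{F}_2$ with $\binom{n}{d+1}\left(1-o_n(1)\right)$ $d$-faces.
   Context: Over $\mathbb{F}_2$, let $\partial_d$ be the matrix with rows indexed by $\binom{[n]}{d}$ and columns by $\binom{[n]}{d+1}$, the column of a $(d+1)$-set $\sigma$ ($d$-face) being the indicator vector of its $d+1$ subsets of size $d$. A set of $d$-faces is acyclic if its columns are linearly independent over $\mathbb{F}_2$; a $d$-hypertree is a maximal acyclic set of $d$-faces. A $d$-hypercut is an inclusion-minimal set of $d$-faces meeting every $d$-hypertree. $o_n(1)$ denotes a quantity tending to $0$ as $n\to\infty$. *)

theory Defs
  imports Complex_Main "HOL-Library.Z2" "HOL-Library.Function_Algebras" "HOL-Library.Ramsey"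
begin

text \<open>The field with two elements is the type \<open>bit\<close>; column vectors over it are functions on
  finite vertex sets, with pointwise addition. \<open>nsets A k\<close> is the set of \<open>k\<close>-element subsets
  of \<open>A\<close>.\<close>

definition f2_scale :: "bit \<Rightarrow> (nat set \<Rightarrow> bit) \<Rightarrow> (nat set \<Rightarrow> bit)" where
  "f2_scale c v = (\<lambda>\<tau>. c * v \<tau>)"

interpretation f2: vector_space f2_scale
  by unfold_locales (auto simp: f2_scale_def fun_eq_iff algebra_simps)

definition faces :: "nat \<Rightarrow> nat \<Rightarrow> nat set set" where
  "faces n d = nsets {1..n} (d + 1)"

text \<open>The entry of the boundary matrix in row \<open>\<tau>\<close> and column \<open>\<sigma>\<close>. Outside the index sets
  of rows and columns it is set to 0, which does not affect linear dependencies.\<close>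

definition boundary :: "nat \<Rightarrow> nat \<Rightarrow> nat set \<Rightarrow> nat set \<Rightarrow> bit" where
  "boundary n d \<tau> \<sigma> =
     (if \<tau> \<in> nsets {1..n} d \<and> \<sigma> \<in> nsets {1..n} (d + 1) \<and> \<tau> \<subseteq> \<sigma> then 1 else 0)"

definition boundary_column :: "nat \<Rightarrow> nat \<Rightarrow> nat set \<Rightarrow> (nat set \<Rightarrow> bit)" where
  "boundary_column n d \<sigma> = (\<lambda>\<tau>. boundary n d \<tau> \<sigma>)"

text \<open>Linear independence is that of the family of columns indexed by \<open>F\<close>, hence the injectivity
  (which is automatic for \<open>d \<ge> 1\<close>).\<close>

definition acyclic_faces :: "nat \<Rightarrow> nat \<Rightarrow> nat set set \<Rightarrow> bool" where
  "acyclic_faces n d F \<longleftrightarrow>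
     F \<subseteq> faces n d \<and> inj_on (boundary_column n d) F \<and>
     f2.independent (boundary_column n d ` F)"

definition hypertree :: "nat \<Rightarrow> nat \<Rightarrow> nat set set \<Rightarrow> bool" where
  "hypertree n d T \<longleftrightarrow>
     acyclic_faces n d T \<and> (\<forall>F. acyclic_faces n d F \<and> T \<subseteq> F \<longrightarrow> F = T)"

definition meets_all_hypertrees :: "nat \<Rightarrow> nat \<Rightarrow> nat set set \<Rightarrow> bool" where
  "meets_all_hypertrees n d C \<longleftrightarrow> (\<forall>T. hypertree n d T \<longrightarrow> C \<inter> T \<noteq> {})"

definition hypercut :: "nat \<Rightarrow> nat \<Rightarrow> nat set set \<Rightarrow> bool" where
  "hypercut n d C \<longleftrightarrow>
     C \<subseteq> faces n d \<and> meets_all_hypertrees n d C \<and>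
     (\<forall>D. D \<subset> C \<longrightarrow> \<not> meets_all_hypertrees n d D)"

end

theory Submission
  imports Defs
begin

text \<open>For a set \<open>H\<close> of \<open>d\<close>-sets, summing the entries over \<open>H\<close> is a linear functional, so the
  \<open>d\<close>-faces with an odd number of facets in \<open>H\<close> meet every hypertree, provided there are any.
  Take for \<open>H\<close> the \<open>d\<close>-subsets of \<open>{1..n-1}\<close> without two consecutive elements, and
  let \<open>B\<close> be the resulting set of faces. If a face has exactly one pair \<open>x, x+1\<close> of
  consecutive elements, its facets in \<open>H\<close> are the two obtained by omitting \<open>x\<close> or \<open>x+1\<close>, so it
  lies outside \<open>B\<close>. Writing every boundary as a sum of boundaries of faces through the
  vertex \<open>n\<close>, one finds that, modulo the columns outside \<open>B\<close>, the columns of all \<open>\<tau> \<union> {n}\<close> with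
  \<open>\<tau> \<in> H\<close> agree, since any two elements of \<open>H\<close> are connected by moving single elements
  to a neighbouring position. So the columns outside \<open>B\<close> have corank one and \<open>B\<close> is minimal.
  If \<open>d\<close> is even, a face of \<open>{1..n-1}\<close> without consecutive elements has \<open>d + 1\<close>, an odd number, of
  facets in \<open>H\<close>, and all but \<open>O(n^d)\<close> of the faces are of this kind.\<close>

section \<open>Hypertrees and spanning sets of columns\<close>

lemma finite_faces: "finite (faces n d)"
  by (simp add: faces_def finite_imp_finite_nsets)

lemma faces_iff: "\<sigma> \<in> faces n d \<longleftrightarrow> \<sigma> \<subseteq> {1..n} \<and> card \<sigma> = d + 1"
  by (auto simp: faces_def nsets_def finite_subset)

lemma card_faces: "card (faces n d) = n choose (d + 1)"
proof -
  have "faces n d = {\<sigma>. \<sigma> \<subseteq> {1..n} \<and> card \<sigma> = d + 1}"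
    using faces_iff by blast
  then show ?thesis
    by (simp add: n_subsets)
qed

text \<open>A face whose column lay outside the span could be added to \<open>T\<close>,
  contradicting maximality.\<close>

lemma hypertree_spans:
  assumes "hypertree n d T" and "\<sigma> \<in> faces n d"
  shows "boundary_column n d \<sigma> \<in> f2.span (boundary_column n d ` T)"
proof (rule ccontr)
  let ?c = "boundary_column n d"
  assume nin: "?c \<sigma> \<notin> f2.span (?c ` T)"
  have T: "T \<subseteq> faces n d" "inj_on ?c T" "f2.independent (?c ` T)"
    using assms(1) by (auto simp: hypertree_def acyclic_faces_def)
  have nin': "?c \<sigma> \<notin> ?c ` T"
    using nin f2.span_base by blast
  have "acyclic_faces n d (insert \<sigma> T)"
    using T nin' assms(2) f2.independent_insertI[OF nin T(3)] by (auto simp: acyclic_faces_def)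
  then have "insert \<sigma> T = T"
    using assms(1) unfolding hypertree_def by blast
  then show False
    using nin' by blast
qed

text \<open>A maximal independent set of columns of \<open>F\<close> lifts to faces \<open>T\<close>
  with distinct columns. It still spans every column, so no acyclic set properly extends
  \<open>T\<close>. Minimality of a cut is derived from this: if the faces outside \<open>D\<close>
  span, then some hypertree misses \<open>D\<close>.\<close>

lemma spanning_contains_hypertree:
  assumes "F \<subseteq> faces n d"
    and "\<And>\<sigma>. \<sigma> \<in> faces n d \<Longrightarrow> boundary_column n d \<sigma> \<in> f2.span (boundary_column n d ` F)"
  obtains T where "T \<subseteq> F" "hypertree n d T"
proof -
  let ?c = "boundary_column n d"
  obtain B where B: "B \<subseteq> ?c ` F" "f2.independent B" "?c ` F \<subseteq> f2.span B"
    using f2.maximal_independent_subset by blast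
  then obtain T where T: "T \<subseteq> F" "inj_on ?c T" "B = ?c ` T"
    by (meson subset_image_inj)
  have ac: "acyclic_faces n d T"
    using assms(1) B T by (auto simp: acyclic_faces_def)
  have "F' = T" if F': "acyclic_faces n d F'" "T \<subseteq> F'" for F'
  proof (rule ccontr)
    assume "F' \<noteq> T"
    then obtain \<sigma> where \<sigma>: "\<sigma> \<in> F'" "\<sigma> \<notin> T"
      using F' by blast
    have F'2: "F' \<subseteq> faces n d" "inj_on ?c F'" "f2.independent (?c ` F')"
      using F' by (auto simp: acyclic_faces_def)
    have "?c \<sigma> \<in> f2.span (?c ` F)"
      using assms(2) F'2 \<sigma> by blast
    then have "?c \<sigma> \<in> f2.span (?c ` T)"
      using f2.span_minimal[OF B(3) f2.subspace_span] T by blast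
    \<comment> \<open>Columns are distinct on \<open>F'\<close>, so removing the column of
      \<open>\<sigma>\<close> loses none of those of \<open>T\<close>.\<close>
    moreover have "?c ` T \<subseteq> ?c ` F' - {?c \<sigma>}"
      using F'(2) F'2(2) \<sigma> by (auto simp: inj_on_def)
    ultimately have "?c \<sigma> \<in> f2.span (?c ` F' - {?c \<sigma>})"
      using f2.span_mono by blast
    then show False
      using F'2(3) \<sigma>(1) unfolding f2.dependent_def by blast
  qed
  then show ?thesis
    using that ac T(1) by (auto simp: hypertree_def)
qed

lemma boundary_column_nonzero:
  assumes "\<sigma> \<in> faces n d"
  shows "boundary_column n d \<sigma> \<noteq> 0"
proof
  assume eq: "boundary_column n d \<sigma> = 0"
  obtain x where "x \<in> \<sigma>"
    using assms by (fastforce simp: faces_iff)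
  then have "boundary_column n d \<sigma> (\<sigma> - {x}) = 1"
    using assms by (auto simp: boundary_column_def boundary_def faces_def nsets_def)
  then show False
    using eq by simp
qed

text \<open>Covers the small \<open>n\<close> for which the explicit construction has no room.
  Columns are nonzero, so no hypertree is empty and the set of all faces meets each one; finiteness
  then yields a minimal such set.\<close>

lemma hypercut_exists:
  assumes "n \<ge> d + 1"
  shows "\<exists>C. hypercut n d C"
proof -
  let ?P = "\<lambda>C. C \<subseteq> faces n d \<and> meets_all_hypertrees n d C"
  have face: "{1..d + 1} \<in> faces n d"
    using assms by (auto simp: faces_iff)
  have "T \<noteq> {}" if "hypertree n d T" for T
    using hypertree_spans[OF that face] boundary_column_nonzero[OF face] by auto
  then have "?P (faces n d)"
    by (auto simp: meets_all_hypertrees_def hypertree_def acyclic_faces_def Int_absorb1)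
  moreover have "finite {C. ?P C}"
    by (rule finite_subset[of _ "Pow (faces n d)"]) (auto simp: finite_faces)
  ultimately obtain C where "?P C" "\<And>D. ?P D \<Longrightarrow> D \<subseteq> C \<Longrightarrow> C = D"
    using finite_has_minimal[of "{C. ?P C}"] by auto
  then show ?thesis
    unfolding hypercut_def by (intro exI[of _ C]) blast
qed

section \<open>Coboundaries\<close>

text \<open>The indicator of \<open>H\<close> is read as a cochain over the two-element field; this
  is the support of its image under the transposed boundary matrix.\<close>

definition coboundary :: "nat \<Rightarrow> nat \<Rightarrow> nat set set \<Rightarrow> nat set set" where
  "coboundary n d H = {\<sigma> \<in> faces n d. odd (card {\<tau> \<in> H. \<tau> \<subseteq> \<sigma>})}"

lemma sum_fun_apply: "(\<Sum>x\<in>A. f x) y = (\<Sum>x\<in>A. f x y)"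
  by (induction A rule: infinite_finite_induct) auto

lemma of_nat_bit: "(of_nat k :: bit) = (if odd k then 1 else 0)"
  by (induction k) auto

lemma sum_boundary_column:
  assumes "H \<subseteq> nsets {1..n} d" "\<sigma> \<in> faces n d"
  shows "(\<Sum>\<tau>\<in>H. boundary_column n d \<sigma> \<tau>) = (if \<sigma> \<in> coboundary n d H then 1 else 0)"
proof -
  have fin: "finite H"
    using assms(1) by (rule finite_subset) (simp add: finite_imp_finite_nsets)
  have "(\<Sum>\<tau>\<in>H. boundary_column n d \<sigma> \<tau>) = (\<Sum>\<tau>\<in>H. if \<tau> \<subseteq> \<sigma> then 1 else 0)"
    using assms by (intro sum.cong) (auto simp: boundary_column_def boundary_def faces_def)
  also have "\<dots> = of_nat (card {\<tau> \<in> H. \<tau> \<subseteq> \<sigma>})"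
    using fin by (simp add: sum.If_cases Int_def)
  finally show ?thesis
    using assms by (simp add: of_nat_bit coboundary_def)
qed

lemma coboundary_meets_all_hypertrees:
  assumes "H \<subseteq> nsets {1..n} d" "coboundary n d H \<noteq> {}"
  shows "meets_all_hypertrees n d (coboundary n d H)"
  unfolding meets_all_hypertrees_def
proof (intro allI impI notI)
  let ?c = "boundary_column n d"
  fix T assume T: "hypertree n d T" and disj: "coboundary n d H \<inter> T = {}"
  \<comment> \<open>\<open>K\<close> is the kernel of the functional attached to \<open>H\<close>.
    It contains all columns outside the coboundary and none inside it.\<close>
  define K where "K = {v :: nat set \<Rightarrow> bit. (\<Sum>\<tau>\<in>H. v \<tau>) = 0}"
  have "f2.subspace K"
    unfolding f2.subspace_def K_def
    by (auto simp: sum.distrib f2_scale_def simp del: add_bit_eq_xor mult_bit_eq_and simp flip: sum_distrib_left)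
  moreover have "?c ` T \<subseteq> K"
  proof clarify
    fix \<sigma> assume "\<sigma> \<in> T"
    then have "\<sigma> \<in> faces n d" "\<sigma> \<notin> coboundary n d H"
      using T disj by (auto simp: hypertree_def acyclic_faces_def)
    then show "?c \<sigma> \<in> K"
      using sum_boundary_column[OF assms(1)] by (simp add: K_def)
  qed
  ultimately have "f2.span (?c ` T) \<subseteq> K"
    by (metis f2.span_minimal)
  moreover obtain \<sigma> where \<sigma>: "\<sigma> \<in> coboundary n d H"
    using assms(2) by blast
  ultimately have "?c \<sigma> \<in> K"
    using hypertree_spans[OF T] by (auto simp: coboundary_def)
  then show False
    using sum_boundary_column[OF assms(1), of \<sigma>] \<sigma> by (simp add: K_def coboundary_def)
qed

text \<open>This is \<open>\<partial>\<partial> = 0\<close> for the set \<open>\<sigma> \<union> {n}\<close>.\<close>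

lemma boundary_column_cone:
  assumes "\<sigma> \<subseteq> {1..<n}" "card \<sigma> = d + 1"
  shows "boundary_column n d \<sigma> = (\<Sum>x\<in>\<sigma>. boundary_column n d (insert n (\<sigma> - {x})))"
proof
  fix \<rho>
  have fin: "finite \<sigma>"
    using assms finite_subset by blast
  have n: "n \<notin> \<sigma>" "n \<ge> 1"
    using assms by (auto simp: Suc_le_eq intro: gr0I)
  have \<sigma>: "\<sigma> \<in> nsets {1..n} (d + 1)"
    using assms fin by (auto simp: nsets_def)
  have ins: "insert n (\<sigma> - {x}) \<in> nsets {1..n} (d + 1)" if "x \<in> \<sigma>" for x
    using assms fin n that by (auto simp: nsets_def)
  show "boundary_column n d \<sigma> \<rho> = (\<Sum>x\<in>\<sigma>. boundary_column n d (insert n (\<sigma> - {x}))) \<rho>"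
  proof (cases "\<rho> \<in> nsets {1..n} d")
    case False
    then show ?thesis
      by (auto simp: boundary_column_def boundary_def sum_fun_apply)
  next
    case True
    have \<rho>: "finite \<rho>" "card \<rho> = d"
      using True by (auto simp: nsets_def)
    \<comment> \<open>In row \<open>\<rho>\<close> the term for \<open>x\<close> is 1 exactly when
      \<open>\<rho>\<close> avoids \<open>x\<close> and lies in \<open>\<sigma>\<close> up to the
      apex \<open>n\<close>.\<close>
    have "(\<Sum>x\<in>\<sigma>. boundary_column n d (insert n (\<sigma> - {x}))) \<rho>
        = (\<Sum>x\<in>\<sigma>. if \<rho> - {n} \<subseteq> \<sigma> \<and> x \<notin> \<rho> then 1 else 0)"
      unfolding sum_fun_apply using True ins n
      by (intro sum.cong) (auto simp: boundary_column_def boundary_def)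
    also have "\<dots> = of_nat (if \<rho> - {n} \<subseteq> \<sigma> then card (\<sigma> - \<rho>) else 0)"
      using fin by (auto simp: sum.If_cases set_diff_eq Int_def)
    also have "\<dots> = (if \<rho> \<subseteq> \<sigma> then 1 else 0)"
    proof (cases "\<rho> - {n} \<subseteq> \<sigma>")
      case sub: True
      have "card (\<sigma> - \<rho>) = card \<sigma> - card (\<rho> - {n})"
      proof -
        have "\<sigma> - \<rho> = \<sigma> - (\<rho> - {n})"
          using n by blast
        then show ?thesis
          using card_Diff_subset[OF _ sub] \<rho> by simp
      qed
      moreover have "card \<rho> \<ge> 1" if "n \<in> \<rho>"
        using that \<rho>(1) by (metis One_nat_def Suc_le_eq card_gt_0_iff empty_iff)
      \<comment> \<open>A row through the apex is hit twice and cancels mod 2; a facet of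
        \<open>\<sigma>\<close> is hit once.\<close>
      ultimately have "card (\<sigma> - \<rho>) = (if n \<in> \<rho> then 2 else 1)"
        using \<rho> assms(2) by auto
      moreover have "\<rho> \<subseteq> \<sigma> \<longleftrightarrow> n \<notin> \<rho>"
        using sub n by blast
      ultimately show ?thesis
        using sub by simp
    qed auto
    finally show ?thesis
      using True \<sigma> by (simp add: boundary_column_def boundary_def)
  qed
qed


section \<open>Cones with apex \<open>n\<close> and a criterion for hypercuts\<close>

lemma cone_in_faces:
  assumes "\<tau> \<in> nsets {1..<n} d" "n \<ge> 1"
  shows "insert n \<tau> \<in> faces n d"
proof -
  have "n \<notin> \<tau>"
    using assms(1) by (auto simp: nsets_def)
  then show ?thesis
    using assms by (auto simp: faces_iff nsets_def)
qed

text \<open>Members of \<open>H\<close> avoid \<open>n\<close>, so \<open>\<tau>\<close> is the only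
  facet of the cone that can belong to \<open>H\<close>.\<close>

lemma cone_in_coboundary_iff:
  assumes "H \<subseteq> nsets {1..<n} d" "\<tau> \<in> nsets {1..<n} d" "n \<ge> 1"
  shows "insert n \<tau> \<in> coboundary n d H \<longleftrightarrow> \<tau> \<in> H"
proof -
  have \<tau>: "finite \<tau>" "card \<tau> = d" "n \<notin> \<tau>" "\<tau> \<subseteq> {1..<n}"
    using assms(2) by (auto simp: nsets_def)
  have "\<rho> = \<tau>" if "\<rho> \<in> H" "\<rho> \<subseteq> insert n \<tau>" for \<rho>
  proof (rule card_subset_eq)
    show "\<rho> \<subseteq> \<tau>" "card \<rho> = card \<tau>"
      using that assms(1) \<tau> by (auto simp: nsets_def subset_iff)
  qed (fact \<tau>)
  then have "{\<rho> \<in> H. \<rho> \<subseteq> insert n \<tau>} = (if \<tau> \<in> H then {\<tau>} else {})"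
    by auto
  then show ?thesis
    using cone_in_faces[OF assms(2,3)] by (simp add: coboundary_def)
qed

lemma base_in_coboundary_iff:
  assumes "H \<subseteq> nsets {1..<n} d" "\<sigma> \<subseteq> {1..<n}" "card \<sigma> = d + 1"
  shows "\<sigma> \<in> coboundary n d H \<longleftrightarrow> odd (card {x \<in> \<sigma>. \<sigma> - {x} \<in> H})"
proof -
  have fin: "finite \<sigma>"
    using assms(2) finite_subset by blast
  have "\<rho> \<in> (\<lambda>x. \<sigma> - {x}) ` {x \<in> \<sigma>. \<sigma> - {x} \<in> H}" if \<rho>: "\<rho> \<in> H" "\<rho> \<subseteq> \<sigma>" for \<rho>
  proof -
    have "card (\<sigma> - \<rho>) = 1"
      using \<rho> assms(1,3) by (subst card_Diff_subset) (auto simp: nsets_def)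
    then obtain x where "\<sigma> - \<rho> = {x}"
      by (auto simp: card_1_singleton_iff)
    then have "\<rho> = \<sigma> - {x}" "x \<in> \<sigma>"
      using \<rho>(2) by auto
    then show ?thesis
      using \<rho>(1) by auto
  qed
  then have "{\<rho> \<in> H. \<rho> \<subseteq> \<sigma>} = (\<lambda>x. \<sigma> - {x}) ` {x \<in> \<sigma>. \<sigma> - {x} \<in> H}"
    by auto
  moreover have "inj_on (\<lambda>x. \<sigma> - {x}) {x \<in> \<sigma>. \<sigma> - {x} \<in> H}"
    by (auto simp: inj_on_def)
  moreover have "\<sigma> \<in> faces n d"
    using assms by (auto simp: faces_iff)
  ultimately show ?thesis
    by (simp add: coboundary_def card_image)
qed

text \<open>This is the corank bound: modulo \<open>W\<close>, cones over members of
  \<open>H\<close> equal \<open>u\<close> and all other cones vanish. Expanding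
  \<open>\<sigma>\<close> into cones therefore leaves an odd number of copies of
  \<open>u\<close>.\<close>

lemma boundary_column_mod_noncut:
  fixes u :: "nat set \<Rightarrow> bit" and n d H
  defines "W \<equiv> f2.span (boundary_column n d ` (faces n d - coboundary n d H))"
  assumes H: "H \<subseteq> nsets {1..<n} d" and n: "n \<ge> 1"
    and u: "\<And>\<tau>. \<tau> \<in> H \<Longrightarrow> boundary_column n d (insert n \<tau>) - u \<in> W"
    and \<sigma>: "\<sigma> \<in> coboundary n d H"
  shows "boundary_column n d \<sigma> - u \<in> W"
proof -
  let ?c = "boundary_column n d"
  have face: "\<sigma> \<subseteq> {1..n}" "card \<sigma> = d + 1"
    using \<sigma> by (auto simp: coboundary_def faces_iff)
  have fin: "finite \<sigma>"
    using face finite_subset by blast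
  show ?thesis
  proof (cases "n \<in> \<sigma>")
    case True
    have "\<sigma> - {n} \<in> nsets {1..<n} d"
      using face fin True by (auto simp: nsets_def le_less)
    moreover have "insert n (\<sigma> - {n}) = \<sigma>"
      using True by blast
    ultimately show ?thesis
      using cone_in_coboundary_iff[OF H _ n, of "\<sigma> - {n}"] u[of "\<sigma> - {n}"] \<sigma> by simp
  next
    case False
    then have sub: "\<sigma> \<subseteq> {1..<n}"
      using face by (auto simp: subset_iff le_less)
    \<comment> \<open>The class modulo \<open>W\<close> of the cone over the facet that omits
      \<open>x\<close>.\<close>
    let ?w = "\<lambda>x. if \<sigma> - {x} \<in> H then u else 0"
    have "?c (insert n (\<sigma> - {x})) - ?w x \<in> W" if "x \<in> \<sigma>" for x
    proof (cases "\<sigma> - {x} \<in> H")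
      case nin: False
      have "\<sigma> - {x} \<in> nsets {1..<n} d"
        using sub face(2) fin that by (auto simp: nsets_def)
      then have "insert n (\<sigma> - {x}) \<in> faces n d - coboundary n d H"
        using cone_in_coboundary_iff[OF H _ n] cone_in_faces[OF _ n] nin by blast
      then show ?thesis
        using nin by (auto simp: W_def intro: f2.span_base)
    qed (use u in auto)
    then have "(\<Sum>x\<in>\<sigma>. ?c (insert n (\<sigma> - {x})) - ?w x) \<in> W"
      unfolding W_def by (intro f2.span_sum) auto
    then have "?c \<sigma> - (\<Sum>x\<in>\<sigma>. ?w x) \<in> W"
      by (simp only: boundary_column_cone[OF sub face(2)] sum_subtractf)
    moreover have "(\<Sum>x\<in>\<sigma>. ?w x) = u"
    proof
      fix \<rho>
      have "(\<Sum>x\<in>\<sigma>. ?w x) = (\<Sum>x\<in>{x \<in> \<sigma>. \<sigma> - {x} \<in> H}. u)"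
        using fin by (simp only: sum.inter_filter)
      then have "(\<Sum>x\<in>\<sigma>. ?w x) \<rho> = of_nat (card {x \<in> \<sigma>. \<sigma> - {x} \<in> H}) * u \<rho>"
        by (simp add: sum_fun_apply del: mult_bit_eq_and)
      then show "(\<Sum>x\<in>\<sigma>. ?w x) \<rho> = u \<rho>"
        using base_in_coboundary_iff[OF H sub face(2)] \<sigma>
        by (simp add: of_nat_bit del: mult_bit_eq_and)
    qed
    ultimately show ?thesis
      by simp
  qed
qed

text \<open>If all cones over \<open>H\<close> share one class \<open>u\<close> modulo the columns
  outside the coboundary, then restoring any single face of the coboundary makes those columns span
  everything. Hence a proper subset \<open>D\<close> misses some hypertree.\<close>

lemma hypercut_coboundary:
  fixes u :: "nat set \<Rightarrow> bit"
  assumes H: "H \<subseteq> nsets {1..<n} d" "H \<noteq> {}" and n: "n \<ge> 1"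
    and u: "\<And>\<tau>. \<tau> \<in> H \<Longrightarrow> boundary_column n d (insert n \<tau>) - u
          \<in> f2.span (boundary_column n d ` (faces n d - coboundary n d H))"
  shows "hypercut n d (coboundary n d H)"
proof -
  let ?c = "boundary_column n d" and ?B = "coboundary n d H"
  note mod_W = boundary_column_mod_noncut[OF H(1) n u]
  have B: "?B \<subseteq> faces n d"
    by (auto simp: coboundary_def)
  obtain \<tau> where "\<tau> \<in> H"
    using H(2) by blast
  then have "insert n \<tau> \<in> ?B"
    using cone_in_coboundary_iff[OF H(1) _ n] H(1) by blast
  moreover have "H \<subseteq> nsets {1..n} d"
    using H(1) by (force simp: nsets_def)
  ultimately have "meets_all_hypertrees n d ?B"
    by (intro coboundary_meets_all_hypertrees) auto
  moreover have "\<not> meets_all_hypertrees n d D" if D: "D \<subset> ?B" for D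
  proof -
    let ?V = "f2.span (?c ` (faces n d - D))"
    obtain e where e: "e \<in> ?B" "e \<notin> D"
      using D by blast
    have sub: "f2.span (?c ` (faces n d - ?B)) \<subseteq> ?V"
      using D by (intro f2.span_mono) auto
    have "?c e \<in> ?V"
      using e B by (auto intro: f2.span_base)
    \<comment> \<open>The spared face \<open>e\<close> brings \<open>u\<close> itself into the
      span.\<close>
    then have "?c e - (?c e - u) \<in> ?V"
      using mod_W[OF _ e(1)] sub by (blast intro: f2.span_diff)
    then have "u \<in> ?V"
      by simp
    have "?c \<sigma> \<in> ?V" if "\<sigma> \<in> faces n d" for \<sigma>
    proof (cases "\<sigma> \<in> ?B")
      case True
      then have "(?c \<sigma> - u) + u \<in> ?V"
        using mod_W[OF _ True] sub \<open>u \<in> ?V\<close> by (blast intro: f2.span_add)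
      then show ?thesis
        by simp
    next
      case False
      then show ?thesis
        using that D by (auto intro: f2.span_base)
    qed
    then obtain T where "T \<subseteq> faces n d - D" "hypertree n d T"
      using spanning_contains_hypertree[of "faces n d - D" n d] by blast
    then show ?thesis
      by (auto simp: meets_all_hypertrees_def)
  qed
  ultimately show ?thesis
    using B by (simp add: hypercut_def)
qed

section \<open>Sets without consecutive elements\<close>

text \<open>The range stops below \<open>n\<close> to keep that vertex free as the cone
  apex.\<close>

definition sparse_nsets :: "nat \<Rightarrow> nat \<Rightarrow> nat set set" where
  "sparse_nsets n d = {\<tau> \<in> nsets {1..<n} d. \<forall>x\<in>\<tau>. Suc x \<notin> \<tau>}"

lemma sparse_nsets_subset: "sparse_nsets n d \<subseteq> nsets {1..<n} d"
  by (auto simp: sparse_nsets_def)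

lemma odd_numbers_in_sparse_nsets:
  assumes "2 * d \<le> n"
  shows "(\<lambda>i. 2 * i + 1) ` {..<d} \<in> sparse_nsets n d"
proof -
  have "card ((\<lambda>i::nat. 2 * i + 1) ` {..<d}) = d"
    by (subst card_image) (auto simp: inj_on_def)
  then show ?thesis
    using assms by (auto simp: sparse_nsets_def nsets_def) presburger
qed

text \<open>Following predecessors down to 1 shows that all elements are odd. The indices
  \<open>i\<close> of the elements \<open>2 * i + 1\<close> form a finite downward closed set, which
  is an initial segment determined by its size.\<close>

lemma eq_odd_numbers:
  fixes \<tau> :: "nat set"
  assumes "finite \<tau>" and pred: "\<And>x. x \<in> \<tau> \<Longrightarrow> x = 1 \<or> (\<exists>y\<in>\<tau>. x = y + 2)"
  shows "\<tau> = (\<lambda>i. 2 * i + 1) ` {..<card \<tau>}"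
proof -
  let ?f = "\<lambda>i::nat. 2 * i + 1"
  define S where "S = {i. ?f i \<in> \<tau>}"
  have "x \<in> ?f ` S" if "x \<in> \<tau>" for x
    using that
  proof (induction x rule: less_induct)
    case (less x)
    consider "x = 1" | y where "y \<in> \<tau>" "x = y + 2"
      using pred[OF less.prems] by blast
    then show ?case
    proof cases
      case 2
      then obtain i where "i \<in> S" "y = ?f i"
        using less.IH[of y] by auto
      then show ?thesis
        using less.prems 2 by (intro image_eqI[of _ _ "Suc i"]) (auto simp: S_def)
    qed (use less.prems in \<open>auto simp: S_def intro!: image_eqI[of _ _ 0]\<close>)
  qed
  then have \<tau>: "\<tau> = ?f ` S"
    by (auto simp: S_def)
  have inj: "inj_on ?f A" for A
    by (auto simp: inj_on_def)
  have "finite S"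
    using assms(1) inj \<tau> finite_image_iff by metis
  then have ex: "\<exists>k. k \<notin> S"
    using ex_new_if_finite infinite_UNIV_nat by blast
  define k where "k = (LEAST k. k \<notin> S)"
  have k: "k \<notin> S" "\<And>i. i < k \<Longrightarrow> i \<in> S"
    unfolding k_def using LeastI_ex[OF ex] not_less_Least[of _ "\<lambda>k. k \<notin> S"] by blast+
  have down: "i \<in> S" if "Suc i \<in> S" for i
    using pred[of "?f (Suc i)"] that by (auto simp: S_def)
  have "i \<notin> S" if "k \<le> i" for i
    using that by (induction rule: dec_induct) (use k(1) down in auto)
  then have "S = {..<k}"
    using k(2) by (auto simp: not_le[symmetric])
  then show ?thesis
    using \<tau> card_image[OF inj, of S] by simp
qed

text \<open>Moving one element down by one lowers the sum of the set, and only the set of the first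
  \<open>d\<close> odd numbers admits no such move. This expresses that all sparse sets are
  connected by shifts.\<close>

lemma sparse_nsets_induct [consumes 1, case_names odd_numbers shift]:
  assumes "\<tau> \<in> sparse_nsets n d"
    and base: "P ((\<lambda>i. 2 * i + 1) ` {..<d})"
    and step: "\<And>\<tau> x. \<lbrakk>\<tau> \<in> sparse_nsets n d; Suc x \<in> \<tau>; x \<notin> \<tau>;
          insert x (\<tau> - {Suc x}) \<in> sparse_nsets n d; P (insert x (\<tau> - {Suc x}))\<rbrakk> \<Longrightarrow> P \<tau>"
  shows "P \<tau>"
  using assms(1)
proof (induction "\<Sum>\<tau>" arbitrary: \<tau> rule: less_induct)
  case less
  have \<tau>: "finite \<tau>" "card \<tau> = d" "\<tau> \<subseteq> {1..<n}" "\<And>x. x \<in> \<tau> \<Longrightarrow> Suc x \<notin> \<tau>"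
    using less.prems by (auto simp: sparse_nsets_def nsets_def)
  \<comment> \<open>Sparsity already gives \<open>x \<notin> \<tau>\<close>, so moving
    \<open>Suc x\<close> to \<open>x\<close> can only be obstructed by the lower end of the range or
    by \<open>x - 1\<close>.\<close>
  show ?case
  proof (cases "\<exists>x. x \<ge> 1 \<and> Suc x \<in> \<tau> \<and> x - 1 \<notin> \<tau>")
    case True
    then obtain x where x: "x \<ge> 1" "Suc x \<in> \<tau>" "x - 1 \<notin> \<tau>"
      by blast
    have nin: "x \<notin> \<tau>"
      using \<tau>(4) x(2) by blast
    let ?\<tau> = "insert x (\<tau> - {Suc x})"
    have "card ?\<tau> = d"
      using \<tau>(1,2) x(2) nin card_Suc_Diff1[OF \<tau>(1) x(2)] by simp
    moreover have "Suc y \<notin> ?\<tau>" if "y \<in> ?\<tau>" for y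
      using that \<tau>(4) x by auto
    ultimately have mem: "?\<tau> \<in> sparse_nsets n d"
      using \<tau> x by (auto simp: sparse_nsets_def nsets_def)
    have "\<Sum>\<tau> = Suc x + \<Sum>(\<tau> - {Suc x})"
      using \<tau>(1) x(2) by (rule sum.remove)
    then have "\<Sum>?\<tau> < \<Sum>\<tau>"
      using \<tau>(1) nin by simp
    then show ?thesis
      using step less.hyps less.prems mem nin x(2) by blast
  next
    case False
    have "x = 1 \<or> (\<exists>y\<in>\<tau>. x = y + 2)" if "x \<in> \<tau>" for x
    proof (cases "x = 1")
      case no: False
      have "x \<ge> 2"
        using \<tau>(3) that no by force
      then obtain z where z: "x = Suc (Suc z)"
        by (metis add_2_eq_Suc le_Suc_ex)
      then have "z \<in> \<tau>"
        using spec[of _ "Suc z"] False that by auto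
      then show ?thesis
        using z by auto
    qed auto
    then show ?thesis
      using eq_odd_numbers[OF \<tau>(1)] \<tau>(2) base by metis
  qed
qed

text \<open>The face \<open>insert x \<tau>\<close> has exactly two facets in \<open>H\<close>, the
  sets before and after the shift, since every other facet still contains both \<open>x\<close> and
  \<open>Suc x\<close>. It is thus outside the coboundary, and in its cone expansion all terms but
  these two lie in the span.\<close>

lemma shift_mod_noncut:
  fixes n d
  defines "H \<equiv> sparse_nsets n d"
  assumes \<tau>: "\<tau> \<in> H" and x: "Suc x \<in> \<tau>" "x \<notin> \<tau>" and \<tau>': "insert x (\<tau> - {Suc x}) \<in> H"
  shows "boundary_column n d (insert n \<tau>) - boundary_column n d (insert n (insert x (\<tau> - {Suc x})))
    \<in> f2.span (boundary_column n d ` (faces n d - coboundary n d H))" (is "_ \<in> ?W")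
proof -
  let ?c = "boundary_column n d" and ?\<sigma> = "insert x \<tau>"
  let ?\<tau>' = "insert x (\<tau> - {Suc x})"
  have H: "H \<subseteq> nsets {1..<n} d"
    unfolding H_def by (rule sparse_nsets_subset)
  have fin: "finite \<tau>" "card \<tau> = d" "\<tau> \<subseteq> {1..<n}" "x \<in> {1..<n}"
    using \<tau> \<tau>' H by (auto simp: nsets_def)
  have n: "n \<ge> 1"
    using fin by auto
  have \<sigma>: "?\<sigma> \<subseteq> {1..<n}" "card ?\<sigma> = d + 1" "finite ?\<sigma>"
    using fin x by auto
  have eqs: "?\<sigma> - {x} = \<tau>" "?\<sigma> - {Suc x} = ?\<tau>'"
    using x by auto
  have other: "?\<sigma> - {z} \<notin> H" if "z \<notin> {x, Suc x}" for z
    using that x by (auto simp: H_def sparse_nsets_def)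
  have "{z \<in> ?\<sigma>. ?\<sigma> - {z} \<in> H} = {x, Suc x}"
  proof -
    have "?\<sigma> - {x} \<in> H" "?\<sigma> - {Suc x} \<in> H"
      using \<tau> \<tau>' by (simp_all only: eqs)
    then show ?thesis
      using other x by blast
  qed
  then have "?\<sigma> \<notin> coboundary n d H"
    using base_in_coboundary_iff[OF H \<sigma>(1,2)] by simp
  then have "?c ?\<sigma> \<in> ?W"
    using \<sigma> by (intro f2.span_base imageI) (auto simp: faces_iff)
  moreover have "?c (insert n (?\<sigma> - {z})) \<in> ?W" if z: "z \<in> ?\<sigma> - {x, Suc x}" for z
  proof -
    have "?\<sigma> - {z} \<in> nsets {1..<n} d"
      using \<sigma> z by (auto simp: nsets_def)
    then have "insert n (?\<sigma> - {z}) \<in> faces n d - coboundary n d H"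
      using cone_in_coboundary_iff[OF H _ n] cone_in_faces[OF _ n] other z by blast
    then show ?thesis
      by (auto intro: f2.span_base)
  qed
  then have "(\<Sum>z\<in>?\<sigma> - {x, Suc x}. ?c (insert n (?\<sigma> - {z}))) \<in> ?W"
    by (intro f2.span_sum) auto
  moreover have "?c ?\<sigma> = ?c (insert n \<tau>) + ?c (insert n ?\<tau>')
      + (\<Sum>z\<in>?\<sigma> - {x, Suc x}. ?c (insert n (?\<sigma> - {z})))"
  proof -
    have pair: "sum g {x, Suc x} = g x + g (Suc x)" for g :: "nat \<Rightarrow> nat set \<Rightarrow> bit"
      by simp
    have "(\<Sum>z\<in>?\<sigma>. ?c (insert n (?\<sigma> - {z})))
        = (\<Sum>z\<in>{x, Suc x}. ?c (insert n (?\<sigma> - {z})))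
          + (\<Sum>z\<in>?\<sigma> - {x, Suc x}. ?c (insert n (?\<sigma> - {z})))"
      using \<sigma>(3) x by (subst add.commute, intro sum.subset_diff) auto
    also have "(\<Sum>z\<in>{x, Suc x}. ?c (insert n (?\<sigma> - {z}))) = ?c (insert n \<tau>) + ?c (insert n ?\<tau>')"
      by (simp only: pair eqs)
    finally show ?thesis
      by (simp only: boundary_column_cone[OF \<sigma>(1,2)])
  qed
  ultimately have "?c (insert n \<tau>) + ?c (insert n ?\<tau>') \<in> ?W"
    by (simp only: f2.span_add_eq2)
  \<comment> \<open>Characteristic 2 turns the sum of the two cones into their difference.\<close>
  moreover have "v + w = v - w" for v w :: "nat set \<Rightarrow> bit"
    by (simp add: fun_eq_iff)
  ultimately show ?thesis
    by (simp only:)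
qed

lemma hypercut_coboundary_sparse_nsets:
  assumes "2 * d \<le> n" "n \<ge> 1"
  shows "hypercut n d (coboundary n d (sparse_nsets n d))"
proof (rule hypercut_coboundary[OF sparse_nsets_subset])
  let ?c = "boundary_column n d" and ?o = "(\<lambda>i. 2 * i + 1) ` {..<d}"
  let ?W = "f2.span (?c ` (faces n d - coboundary n d (sparse_nsets n d)))"
  show "sparse_nsets n d \<noteq> {}"
    using odd_numbers_in_sparse_nsets[OF assms(1)] by blast
  fix \<tau> assume "\<tau> \<in> sparse_nsets n d"
  \<comment> \<open>The common class is represented by the cone over 1, 3, ..., 2d-1, which fits
    below \<open>n\<close> because \<open>2 * d \<le> n\<close>.\<close>
  then show "?c (insert n \<tau>) - ?c (insert n ?o) \<in> ?W"
  proof (induction rule: sparse_nsets_induct)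
    case odd_numbers
    show ?case
      by (simp only: diff_self f2.span_zero)
  next
    case (shift \<tau> x)
    let ?\<tau>' = "insert x (\<tau> - {Suc x})"
    \<comment> \<open>The differences along a chain of shifts telescope.\<close>
    have "(?c (insert n \<tau>) - ?c (insert n ?\<tau>')) + (?c (insert n ?\<tau>') - ?c (insert n ?o)) \<in> ?W"
      by (intro f2.span_add shift_mod_noncut shift)
    then show ?case
      by (simp only: add_diff_eq diff_add_cancel)
  qed
qed (fact assms(2))

section \<open>Counting\<close>

lemma card_subsets_containing:
  assumes "A \<subseteq> {1..n}" "n \<ge> 1"
  shows "card {\<sigma> \<in> faces n d. A \<subseteq> \<sigma>} \<le> n ^ (d + 1 - card A)"
proof -
  let ?k = "d + 1 - card A"
  have finA: "finite A"
    using assms(1) finite_subset by blast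
  have "card {\<sigma> \<in> faces n d. A \<subseteq> \<sigma>} \<le> card {B. B \<subseteq> {1..n} \<and> card B = ?k}"
  proof (rule card_inj_on_le[of "\<lambda>\<sigma>. \<sigma> - A"])
    show "inj_on (\<lambda>\<sigma>. \<sigma> - A) {\<sigma> \<in> faces n d. A \<subseteq> \<sigma>}"
      by (auto simp: inj_on_def)
    show "(\<lambda>\<sigma>. \<sigma> - A) ` {\<sigma> \<in> faces n d. A \<subseteq> \<sigma>} \<subseteq> {B. B \<subseteq> {1..n} \<and> card B = ?k}"
      using finA by (auto simp: faces_iff card_Diff_subset)
    show "finite {B. B \<subseteq> {1..n} \<and> card B = ?k}"
      by (rule finite_subset[of _ "Pow {1..n}"]) auto
  qed
  also have "\<dots> = n choose ?k"
    by (simp add: n_subsets)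
  also have "\<dots> \<le> n ^ ?k"
    by (cases "?k \<le> n") (simp_all add: binomial_le_pow binomial_eq_0)
  finally show ?thesis .
qed

text \<open>For even \<open>d\<close>, a face avoiding \<open>n\<close> and without consecutive
  elements has all its \<open>d + 1\<close> facets sparse, an odd number. A face outside the
  coboundary thus contains \<open>n\<close>, or one of fewer than \<open>n\<close> consecutive
  pairs; each of these two kinds contributes at most \<open>n ^ d\<close>.\<close>

lemma card_faces_diff_coboundary_sparse_nsets:
  assumes "even d" "d \<ge> 1" "n \<ge> 1"
  shows "card (faces n d - coboundary n d (sparse_nsets n d)) \<le> 2 * n ^ d"
proof -
  let ?F = "\<lambda>A. {\<sigma> \<in> faces n d. A \<subseteq> \<sigma>}"
  have cut: "\<sigma> \<in> coboundary n d (sparse_nsets n d)"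
    if \<sigma>: "\<sigma> \<in> faces n d" "n \<notin> \<sigma>" "\<And>x. x \<in> \<sigma> \<Longrightarrow> Suc x \<notin> \<sigma>" for \<sigma>
  proof -
    have sub: "\<sigma> \<subseteq> {1..<n}" "card \<sigma> = d + 1"
      using \<sigma>(1,2) by (auto simp: faces_iff subset_iff le_less)
    have "{x \<in> \<sigma>. \<sigma> - {x} \<in> sparse_nsets n d} = \<sigma>"
      using sub \<sigma>(3) finite_subset[OF sub(1)] by (auto simp: sparse_nsets_def nsets_def)
    then show ?thesis
      using base_in_coboundary_iff[OF sparse_nsets_subset sub] sub(2) assms(1) by simp
  qed
  have "faces n d - coboundary n d (sparse_nsets n d)
      \<subseteq> ?F {n} \<union> (\<Union>x\<in>{1..<n}. ?F {x, Suc x})"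
  proof (intro subsetI)
    fix \<sigma> assume \<sigma>: "\<sigma> \<in> faces n d - coboundary n d (sparse_nsets n d)"
    have "x \<in> {1..<n}" if "x \<in> \<sigma>" "Suc x \<in> \<sigma>" for x
      using that \<sigma> by (auto simp: faces_iff)
    moreover have "n \<in> \<sigma> \<or> (\<exists>x\<in>\<sigma>. Suc x \<in> \<sigma>)"
      using cut \<sigma> by blast
    ultimately show "\<sigma> \<in> ?F {n} \<union> (\<Union>x\<in>{1..<n}. ?F {x, Suc x})"
      using \<sigma> by blast
  qed
  then have "card (faces n d - coboundary n d (sparse_nsets n d))
      \<le> card (?F {n} \<union> (\<Union>x\<in>{1..<n}. ?F {x, Suc x}))"
    by (intro card_mono) (auto simp: finite_faces)
  also have "\<dots> \<le> card (?F {n}) + card (\<Union>x\<in>{1..<n}. ?F {x, Suc x})"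
    by (rule card_Un_le)
  also have "card (?F {n}) \<le> n ^ d"
    using card_subsets_containing[of "{n}" n d] assms by auto
  also have "card (\<Union>x\<in>{1..<n}. ?F {x, Suc x}) \<le> (\<Sum>x\<in>{1..<n}. card (?F {x, Suc x}))"
    by (rule card_UN_le) simp
  also have "\<dots> \<le> (\<Sum>x\<in>{1..<n}. n ^ (d - 1))"
  proof (rule sum_mono)
    fix x assume "x \<in> {1..<n}"
    then show "card (?F {x, Suc x}) \<le> n ^ (d - 1)"
      using card_subsets_containing[of "{x, Suc x}" n d] assms by auto
  qed
  also have "\<dots> \<le> n * n ^ (d - 1)"
    by simp
  also have "\<dots> = n ^ d"
    using assms(2) by (simp flip: power_Suc)
  finally show ?thesis
    by simp
qed

section \<open>The density bound and its limit\<close>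

lemma hypercut_almost_full:
  assumes "even d" "d \<ge> 1" "n \<ge> 2 * d"
  obtains C where "hypercut n d C"
    "1 - real (card C) / real (n choose (d + 1)) \<le> 2 * real (d + 1) ^ (d + 1) / real n"
proof
  let ?B = "coboundary n d (sparse_nsets n d)" and ?N = "n choose (d + 1)"
  have n: "n \<ge> 1" "d + 1 \<le> n"
    using assms by auto
  show "hypercut n d ?B"
    using assms n by (intro hypercut_coboundary_sparse_nsets) auto
  \<comment> \<open>With \<open>x = n\<close> and \<open>y = d + 1\<close> this isolates the factor
    \<open>(n / (d + 1)) ^ (d + 1)\<close>, a lower bound for the binomial coefficient.\<close>
  have power_eq: "2 * x ^ d = 2 * y ^ (d + 1) / x * (x / y) ^ (d + 1)" if "x > 0" "y > 0" for x y :: real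
    using that by (simp add: power_divide)
  have pos: "?N > 0"
    using n by simp
  have B: "?B \<subseteq> faces n d"
    by (auto simp: coboundary_def)
  then have "card (faces n d - ?B) = ?N - card ?B" "card ?B \<le> ?N"
    using card_faces card_mono[OF finite_faces B]
    by (simp_all add: card_Diff_subset finite_subset[OF _ finite_faces])
  then have "real ?N - real (card ?B) = real (card (faces n d - ?B))"
    by simp
  also have "\<dots> \<le> 2 * real n ^ d"
    using card_faces_diff_coboundary_sparse_nsets[OF assms(1,2) n(1)]
    by (metis of_nat_le_iff of_nat_mult of_nat_numeral of_nat_power)
  also have "\<dots> = 2 * real (d + 1) ^ (d + 1) / real n * (real n / real (d + 1)) ^ (d + 1)"
    using n by (intro power_eq) auto
  also have "\<dots> \<le> 2 * real (d + 1) ^ (d + 1) / real n * real ?N"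
    by (intro mult_left_mono binomial_ge_n_over_k_pow_k n) auto
  finally show "1 - real (card ?B) / real ?N \<le> 2 * real (d + 1) ^ (d + 1) / real n"
    using pos by (simp add: field_simps)
qed

theorem theorem6:
  fixes d :: nat
  assumes "even d" and "d \<ge> 2"
  shows "\<exists>(C :: nat \<Rightarrow> nat set set) (\<epsilon> :: nat \<Rightarrow> real).
           \<epsilon> \<longlonglongrightarrow> 0 \<and>
           (\<forall>n\<ge>d + 1. hypercut n d (C n) \<and>
              real (card (C n)) = real (n choose (d + 1)) * (1 - \<epsilon> n))"
proof -
  \<comment> \<open>The required equation forces this error term; \<open>?b\<close> is its explicit
    bound.\<close>
  let ?e = "\<lambda>n C. 1 - real (card C) / real (n choose (d + 1))"
  let ?b = "\<lambda>n. 2 * real (d + 1) ^ (d + 1) / real n"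
  \<comment> \<open>Below \<open>2 * d\<close> any hypercut will do, since finitely many
    \<open>n\<close> do not affect the limit.\<close>
  have "\<exists>C. hypercut n d C \<and> (n \<ge> 2 * d \<longrightarrow> ?e n C \<le> ?b n)" if "n \<ge> d + 1" for n
  proof (cases "n \<ge> 2 * d")
    case True
    then show ?thesis
      using hypercut_almost_full[of d n] assms by auto
  qed (use hypercut_exists[OF that] in auto)
  then obtain C where C: "\<And>n. n \<ge> d + 1 \<Longrightarrow> hypercut n d (C n)"
    "\<And>n. n \<ge> d + 1 \<Longrightarrow> n \<ge> 2 * d \<Longrightarrow> ?e n (C n) \<le> ?b n"
    by metis
  have "card (C n) \<le> n choose (d + 1)" if "n \<ge> d + 1" for n
    using C(1)[OF that] card_mono[OF finite_faces, of "C n" n d]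
    by (simp add: hypercut_def card_faces)
  then have "0 \<le> ?e n (C n)" if "n \<ge> d + 1" for n
    using that by (simp add: divide_le_eq_1)
  then have "eventually (\<lambda>n. 0 \<le> ?e n (C n)) sequentially"
    by (intro eventually_sequentiallyI[of "d + 1"])
  moreover have "eventually (\<lambda>n. ?e n (C n) \<le> ?b n) sequentially"
    using C(2) assms(2) by (intro eventually_sequentiallyI[of "2 * d"]) auto
  ultimately have "(\<lambda>n. ?e n (C n)) \<longlonglongrightarrow> 0"
    by (rule tendsto_sandwich[OF _ _ tendsto_const lim_const_over_n])
  then show ?thesis
    using C(1) by (intro exI[of _ C] exI[of _ "\<lambda>n. ?e n (C n)"]) (auto simp: field_simps)
qed

end
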